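(* Suppose that $u: M \to N$ and $f: N \to N'$ are smooth maps. The map $f$ induces a covariant functor $\mathbf{QuasiP}(u) \to \mathbf{QuasiP}(f \circ u)$ and a covariant functor $\mathbf{Const}(u) \to \mathbf{Const}(f \circ u)$.
   Context: $M$, $N$, $N'$ are smooth manifolds. A smooth map has constant rank if its Jacobian has the same rank at every point of the domain. A constant rank factorization of a smooth map $u: M \to N$ is a factorization $u = U \circ \phi$, where $\phi: M \to C$ is a smooth map of constant rank into a manifold $C$ (the phase space) and $U: C \to N$ is smooth; it is written $(\phi, U)$. The category $\mathbf{Const}(u)$ has the constant rank factorizations of $u$ as objects; a morphism $(\phi_1,U_1) \to (\phi_2,U_2)$, with phase spaces $C_1, C_2$, is a smooth map $c: C_1 \to C_2$ such that $\phi_2 = c \circ \phi_1$ and $U_1 = U_2 \circ c$; composition of morphisms is composition of the maps $c$. A quasiperiodic factorization is a factorization $u = U \circ \phi$ in which $\phi$ is a smooth surjective submersion; the category $\mathbf{QuasiP}(u)$ has these as objects, with morphisms defined in exactly the same way. *)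

theory Defs
  imports
    "HOL-Analysis.Analysis"
    "Jordan_Normal_Form.DL_Rank"
begin

section \<open>Smooth functions between open subsets of Euclidean spaces\<close>

text \<open>
  The dimension of a phase space is not fixed in advance, so \<open>n\<close>-dimensional space is
  \<^const>\<open>Euclidean_space\<close> \<open>n\<close>, the space of all \<open>x :: nat \<Rightarrow> real\<close> with \<open>x i = 0\<close> for \<open>i \<ge> n\<close>;
  only the coordinates \<open>i < n\<close> are significant.
\<close>

definition partial_deriv :: "nat \<Rightarrow> ((nat \<Rightarrow> real) \<Rightarrow> real) \<Rightarrow> (nat \<Rightarrow> real) \<Rightarrow> real" where
  "partial_deriv i g a = deriv (\<lambda>t. g (a(i := t))) (a i)"

text \<open>
  The set \<open>S\<close> below is meant to be open in \<^const>\<open>Euclidean_space\<close> \<open>n\<close>; the values of \<open>g\<close>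
  outside \<open>S\<close> are then irrelevant.
\<close>

primrec C_k_on :: "nat \<Rightarrow> nat \<Rightarrow> (nat \<Rightarrow> real) set \<Rightarrow> ((nat \<Rightarrow> real) \<Rightarrow> real) \<Rightarrow> bool" where
  "C_k_on 0 n S g \<longleftrightarrow> continuous_map (subtopology (Euclidean_space n) S) euclideanreal g"
| "C_k_on (Suc k) n S g \<longleftrightarrow>
     continuous_map (subtopology (Euclidean_space n) S) euclideanreal g \<and>
     (\<forall>i<n. (\<forall>a\<in>S. (\<lambda>t. g (a(i := t))) differentiable (at (a i))) \<and>
            C_k_on k n S (partial_deriv i g))"

definition smooth_fun ::
  "nat \<Rightarrow> nat \<Rightarrow> (nat \<Rightarrow> real) set \<Rightarrow> ((nat \<Rightarrow> real) \<Rightarrow> (nat \<Rightarrow> real)) \<Rightarrow> bool" where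
  "smooth_fun n m S F \<longleftrightarrow> (\<forall>j<m. \<forall>k. C_k_on k n S (\<lambda>a. F a j))"

definition jacobian ::
  "nat \<Rightarrow> nat \<Rightarrow> ((nat \<Rightarrow> real) \<Rightarrow> (nat \<Rightarrow> real)) \<Rightarrow> (nat \<Rightarrow> real) \<Rightarrow> real mat" where
  "jacobian n m F a = mat m n (\<lambda>(j, i). partial_deriv i (\<lambda>z. F z j) a)"


section \<open>Smooth manifolds\<close>

text \<open>
  A chart is a pair \<open>(U, x)\<close> of an open set and a homeomorphism of it onto an open
  subset of Euclidean space. Being extensional on \<open>U\<close>, the function \<open>x\<close> is determined by
  its values on \<open>U\<close>.
\<close>

type_synonym 'a chart = "'a set \<times> ('a \<Rightarrow> nat \<Rightarrow> real)"

record 'a manifold =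
  mtop :: "'a topology"
  mdim :: nat
  atlas :: "'a chart set"

definition points :: "'a manifold \<Rightarrow> 'a set" where
  "points M = topspace (mtop M)"

definition is_chart :: "'a topology \<Rightarrow> nat \<Rightarrow> 'a chart \<Rightarrow> bool" where
  "is_chart X n = (\<lambda>(U, x).
     openin X U \<and> x \<in> extensional U \<and> openin (Euclidean_space n) (x ` U) \<and>
     homeomorphic_map (subtopology X U) (subtopology (Euclidean_space n) (x ` U)) x)"

definition smooth_transition :: "nat \<Rightarrow> 'a chart \<Rightarrow> 'a chart \<Rightarrow> bool" where
  "smooth_transition n = (\<lambda>(U, x) (V, y). smooth_fun n n (x ` (U \<inter> V)) (y \<circ> inv_into U x))"

definition compatible :: "nat \<Rightarrow> 'a chart \<Rightarrow> 'a chart \<Rightarrow> bool" where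
  "compatible n \<kappa> \<mu> \<longleftrightarrow> smooth_transition n \<kappa> \<mu> \<and> smooth_transition n \<mu> \<kappa>"

definition smooth_manifold :: "'a manifold \<Rightarrow> bool" where
  "smooth_manifold M \<longleftrightarrow>
     Hausdorff_space (mtop M) \<and> second_countable (mtop M) \<and>
     (\<forall>\<kappa>\<in>atlas M. is_chart (mtop M) (mdim M) \<kappa>) \<and>
     (\<forall>p\<in>points M. \<exists>(U, x)\<in>atlas M. p \<in> U) \<and>
     (\<forall>\<kappa>\<in>atlas M. \<forall>\<mu>\<in>atlas M. compatible (mdim M) \<kappa> \<mu>) \<and>
     (\<forall>\<kappa>. is_chart (mtop M) (mdim M) \<kappa> \<and> (\<forall>\<mu>\<in>atlas M. compatible (mdim M) \<kappa> \<mu>)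
           \<longrightarrow> \<kappa> \<in> atlas M)"

definition coord_rep ::
  "('a \<Rightarrow> 'b) \<Rightarrow> 'a chart \<Rightarrow> 'b chart \<Rightarrow> (nat \<Rightarrow> real) \<Rightarrow> (nat \<Rightarrow> real)" where
  "coord_rep f = (\<lambda>(U, x) (V, y). y \<circ> f \<circ> inv_into U x)"

definition smooth_map :: "'a manifold \<Rightarrow> 'b manifold \<Rightarrow> ('a \<Rightarrow> 'b) \<Rightarrow> bool" where
  "smooth_map M N f \<longleftrightarrow>
     continuous_map (mtop M) (mtop N) f \<and>
     (\<forall>(U, x)\<in>atlas M. \<forall>(V, y)\<in>atlas N.
        smooth_fun (mdim M) (mdim N) (x ` {p\<in>U. f p \<in> V}) (coord_rep f (U, x) (V, y)))"

text \<open>The rank of the Jacobian does not depend on the charts around \<open>p\<close> and \<open>f p\<close>.\<close>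

definition has_rank_at :: "'a manifold \<Rightarrow> 'b manifold \<Rightarrow> ('a \<Rightarrow> 'b) \<Rightarrow> 'a \<Rightarrow> nat \<Rightarrow> bool" where
  "has_rank_at M N f p r \<longleftrightarrow>
     (\<forall>(U, x)\<in>atlas M. \<forall>(V, y)\<in>atlas N. p \<in> U \<and> f p \<in> V \<longrightarrow>
        vec_space.rank (mdim N)
          (jacobian (mdim M) (mdim N) (coord_rep f (U, x) (V, y)) (x p)) = r)"

definition constant_rank :: "'a manifold \<Rightarrow> 'b manifold \<Rightarrow> ('a \<Rightarrow> 'b) \<Rightarrow> bool" where
  "constant_rank M N f \<longleftrightarrow> (\<exists>r. \<forall>p\<in>points M. has_rank_at M N f p r)"

definition submersion :: "'a manifold \<Rightarrow> 'b manifold \<Rightarrow> ('a \<Rightarrow> 'b) \<Rightarrow> bool" where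
  "submersion M N f \<longleftrightarrow> smooth_map M N f \<and> (\<forall>p\<in>points M. has_rank_at M N f p (mdim N))"


section \<open>Categories and functors\<close>

record ('o, 'a) cat =
  Objs :: "'o set"
  Arrs :: "'a set"
  Src :: "'a \<Rightarrow> 'o"
  Tgt :: "'a \<Rightarrow> 'o"
  Ident :: "'o \<Rightarrow> 'a"
  Cmp :: "'a \<Rightarrow> 'a \<Rightarrow> 'a"

text \<open>\<open>Cmp A h g\<close> is \<open>h\<close> after \<open>g\<close>, significant only if \<open>Src A h = Tgt A g\<close>.\<close>

locale category =
  fixes A :: "('o, 'a) cat"
  assumes Src_in: "g \<in> Arrs A \<Longrightarrow> Src A g \<in> Objs A"
    and Tgt_in: "g \<in> Arrs A \<Longrightarrow> Tgt A g \<in> Objs A"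
    and Ident_in: "X \<in> Objs A \<Longrightarrow> Ident A X \<in> Arrs A"
    and Src_Ident: "X \<in> Objs A \<Longrightarrow> Src A (Ident A X) = X"
    and Tgt_Ident: "X \<in> Objs A \<Longrightarrow> Tgt A (Ident A X) = X"
    and Cmp_in: "\<lbrakk>g \<in> Arrs A; h \<in> Arrs A; Src A h = Tgt A g\<rbrakk> \<Longrightarrow> Cmp A h g \<in> Arrs A"
    and Src_Cmp: "\<lbrakk>g \<in> Arrs A; h \<in> Arrs A; Src A h = Tgt A g\<rbrakk> \<Longrightarrow> Src A (Cmp A h g) = Src A g"
    and Tgt_Cmp: "\<lbrakk>g \<in> Arrs A; h \<in> Arrs A; Src A h = Tgt A g\<rbrakk> \<Longrightarrow> Tgt A (Cmp A h g) = Tgt A h"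
    and Cmp_Ident_right: "g \<in> Arrs A \<Longrightarrow> Cmp A g (Ident A (Src A g)) = g"
    and Cmp_Ident_left: "g \<in> Arrs A \<Longrightarrow> Cmp A (Ident A (Tgt A g)) g = g"
    and Cmp_assoc: "\<lbrakk>g \<in> Arrs A; h \<in> Arrs A; k \<in> Arrs A; Src A h = Tgt A g; Src A k = Tgt A h\<rbrakk>
      \<Longrightarrow> Cmp A k (Cmp A h g) = Cmp A (Cmp A k h) g"

locale covariant_functor = dom: category A + cod: category B
  for A :: "('o1, 'a1) cat" and B :: "('o2, 'a2) cat" +
  fixes Fo :: "'o1 \<Rightarrow> 'o2" and Fa :: "'a1 \<Rightarrow> 'a2"
  assumes Fo_in: "X \<in> Objs A \<Longrightarrow> Fo X \<in> Objs B"
    and Fa_in: "g \<in> Arrs A \<Longrightarrow> Fa g \<in> Arrs B"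
    and Src_Fa: "g \<in> Arrs A \<Longrightarrow> Src B (Fa g) = Fo (Src A g)"
    and Tgt_Fa: "g \<in> Arrs A \<Longrightarrow> Tgt B (Fa g) = Fo (Tgt A g)"
    and Fa_Ident: "X \<in> Objs A \<Longrightarrow> Fa (Ident A X) = Ident B (Fo X)"
    and Fa_Cmp: "\<lbrakk>g \<in> Arrs A; h \<in> Arrs A; Src A h = Tgt A g\<rbrakk>
      \<Longrightarrow> Fa (Cmp A h g) = Cmp B (Fa h) (Fa g)"


section \<open>Factorizations of a smooth map\<close>

text \<open>
  The underlying set of a phase space is a subset of an arbitrary type \<open>'c\<close>, which plays the
  role of the universe. A second countable Hausdorff manifold has at most continuum
  many points, so already \<open>'c = real\<close> admits every phase space up to diffeomorphism.
  All maps out of a manifold occurring in objects and arrows are extensional, so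
  that equality of HOL functions is equality of maps on that manifold.
\<close>

record ('m, 'c, 'n) factorization =
  phase :: "'c manifold"
  inner :: "'m \<Rightarrow> 'c"
  outer :: "'c \<Rightarrow> 'n"

definition smooth_factorization ::
  "'m manifold \<Rightarrow> 'n manifold \<Rightarrow> ('m \<Rightarrow> 'n) \<Rightarrow> ('m, 'c, 'n) factorization \<Rightarrow> bool" where
  "smooth_factorization M N u X \<longleftrightarrow>
     smooth_manifold (phase X) \<and>
     inner X \<in> extensional (points M) \<and> smooth_map M (phase X) (inner X) \<and>
     outer X \<in> extensional (points (phase X)) \<and> smooth_map (phase X) N (outer X) \<and>
     (\<forall>p\<in>points M. u p = outer X (inner X p))"

definition constant_rank_factorization ::
  "'m manifold \<Rightarrow> 'n manifold \<Rightarrow> ('m \<Rightarrow> 'n) \<Rightarrow> ('m, 'c, 'n) factorization \<Rightarrow> bool" where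
  "constant_rank_factorization M N u X \<longleftrightarrow>
     smooth_factorization M N u X \<and> constant_rank M (phase X) (inner X)"

definition quasiperiodic_factorization ::
  "'m manifold \<Rightarrow> 'n manifold \<Rightarrow> ('m \<Rightarrow> 'n) \<Rightarrow> ('m, 'c, 'n) factorization \<Rightarrow> bool" where
  "quasiperiodic_factorization M N u X \<longleftrightarrow>
     smooth_factorization M N u X \<and> submersion M (phase X) (inner X) \<and>
     inner X ` points M = points (phase X)"

definition is_morphism ::
  "'m manifold \<Rightarrow> ('m, 'c, 'n) factorization \<Rightarrow> ('c \<Rightarrow> 'c) \<Rightarrow> ('m, 'c, 'n) factorization \<Rightarrow> bool"
where
  "is_morphism M X c Y \<longleftrightarrow>
     c \<in> extensional (points (phase X)) \<and> smooth_map (phase X) (phase Y) c \<and>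
     (\<forall>p\<in>points M. inner Y p = c (inner X p)) \<and>
     (\<forall>q\<in>points (phase X). outer X q = outer Y (c q))"

type_synonym ('m, 'c, 'n) arrow =
  "('m, 'c, 'n) factorization \<times> ('c \<Rightarrow> 'c) \<times> ('m, 'c, 'n) factorization"

definition factorization_cat ::
  "'m manifold \<Rightarrow> ('m, 'c, 'n) factorization set
    \<Rightarrow> (('m, 'c, 'n) factorization, ('m, 'c, 'n) arrow) cat" where
  "factorization_cat M F =
     \<lparr>Objs = F,
      Arrs = {(X, c, Y). X \<in> F \<and> Y \<in> F \<and> is_morphism M X c Y},
      Src = (\<lambda>(X, c, Y). X),
      Tgt = (\<lambda>(X, c, Y). Y),
      Ident = (\<lambda>X. (X, restrict id (points (phase X)), X)),
      Cmp = (\<lambda>(Y', d, Z) (X, c, Y). (X, compose (points (phase X)) d c, Z))\<rparr>"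

definition Const ::
  "'m manifold \<Rightarrow> 'n manifold \<Rightarrow> ('m \<Rightarrow> 'n)
    \<Rightarrow> (('m, 'c, 'n) factorization, ('m, 'c, 'n) arrow) cat" where
  "Const M N u = factorization_cat M {X. constant_rank_factorization M N u X}"

definition QuasiP ::
  "'m manifold \<Rightarrow> 'n manifold \<Rightarrow> ('m \<Rightarrow> 'n)
    \<Rightarrow> (('m, 'c, 'n) factorization, ('m, 'c, 'n) arrow) cat" where
  "QuasiP M N u = factorization_cat M {X. quasiperiodic_factorization M N u X}"

text \<open>The functor induced by \<open>f\<close> sends \<open>(\<phi>, U)\<close> to \<open>(\<phi>, f \<circ> U)\<close> and the map \<open>c\<close> to itself.\<close>

definition induced_obj ::
  "('n \<Rightarrow> 'k) \<Rightarrow> ('m, 'c, 'n) factorization \<Rightarrow> ('m, 'c, 'k) factorization" where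
  "induced_obj f X =
     \<lparr>phase = phase X, inner = inner X, outer = compose (points (phase X)) f (outer X)\<rparr>"

definition induced_arr :: "('n \<Rightarrow> 'k) \<Rightarrow> ('m, 'c, 'n) arrow \<Rightarrow> ('m, 'c, 'k) arrow" where
  "induced_arr f = (\<lambda>(X, c, Y). (induced_obj f X, c, induced_obj f Y))"

end

(*
  The only analytic content is that smooth maps of manifolds compose: then (phi, f o U) is a
  smooth factorization of f o u with the same inner map phi, so its rank, surjectivity and
  submersivity are unchanged, and c is still a morphism. Composition is local, so it reduces in
  charts to the C^k chain rule; the total differentiability it needs follows from continuity of
  the partial derivatives by changing one coordinate at a time and applying the mean value theorem.
*)

theory Submission
  imports Defs
begin

section \<open>Calculus of \<open>C\<^sup>k\<close> functions\<close>

text \<open>Points are elements of \<open>nat \<Rightarrow> real\<close> with the product topology,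
  which is not normable, so a total derivative is avoided altogether. The i-th partial derivative of
  g \<circ> F at a is the derivative of g along the curve t \<mapsto> F (a(i := t)), so a chain rule
  along differentiable curves in one real parameter suffices. Two encodings shape the rest. A set
  open in \<open>Euclidean_space n\<close> is not open in the whole function type: its points vanish
  from coordinate n on, so neighbourhoods are boxes in the first n coordinates. Arrows are
  extensional functions, and \<open>compose\<close> and \<open>restrict\<close> agree with
  composition and identity only on the points of a phase space; hence the category laws depend on
  maps landing in the right point sets.\<close>

lemma Euclidean_space_eq: "Euclidean_space n = top_of_set {x. \<forall>i\<ge>n. x i = 0}"
  by (simp add: Euclidean_space_def euclidean_product_topology)

lemma openin_Euclidean_space_subset: "openin (Euclidean_space n) S \<Longrightarrow> S \<subseteq> {x. \<forall>i\<ge>n. x i = 0}"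
  using openin_subset topspace_Euclidean_space by blast

lemma continuous_map_open_Euclidean_space_iff:
  assumes "openin (Euclidean_space n) S"
  shows "continuous_map (subtopology (Euclidean_space n) S) euclideanreal g \<longleftrightarrow> continuous_on S g"
proof -
  have "subtopology (Euclidean_space n) S = top_of_set S"
    using openin_Euclidean_space_subset[OF assms]
    by (simp add: Euclidean_space_eq subtopology_subtopology Int_absorb1)
  then show ?thesis by simp
qed

text \<open>A basic open set of the product topology restricts only finitely many coordinates, so
  finitely many radii have a positive minimum.\<close>

lemma open_contains_box:
  fixes T :: "('i \<Rightarrow> real) set"
  assumes "open T" "p \<in> T"
  obtains e where "e > 0" "\<And>q. (\<And>i. \<bar>q i - p i\<bar> < e) \<Longrightarrow> q \<in> T"
proof -
  obtain U where fin: "finite {i. U i \<noteq> UNIV}" and op: "\<And>i. open (U i)"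
    and p: "\<And>i. p i \<in> U i" and sub: "Pi\<^sub>E UNIV U \<subseteq> T"
    using assms by (auto simp: open_fun_def openin_product_topology_alt PiE_iff)
  have "\<forall>i. \<exists>e>0. \<forall>s. \<bar>s - p i\<bar> < e \<longrightarrow> s \<in> U i"
    using op p by (metis open_real)
  then obtain E where E: "\<And>i. E i > 0" "\<And>i s. \<bar>s - p i\<bar> < E i \<Longrightarrow> s \<in> U i"
    by metis
  \<comment> \<open>The 1 keeps the set nonempty when no coordinate is restricted.\<close>
  let ?e = "Min (insert 1 (E ` {i. U i \<noteq> UNIV}))"
  show thesis
  proof
    show "?e > 0" using fin E by auto
    fix q assume q: "\<And>i. \<bar>q i - p i\<bar> < ?e"
    have "q i \<in> U i" for i
    proof (cases "U i = UNIV")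
      case False
      then have "?e \<le> E i" using fin by auto
      then show ?thesis using q[of i] E(2) by force
    qed auto
    then show "q \<in> T" using sub by auto
  qed
qed

lemma openin_Euclidean_space_contains_box:
  assumes "openin (Euclidean_space n) S" "p \<in> S"
  obtains e where "e > 0"
    "\<And>q. \<lbrakk>\<And>i. i < n \<Longrightarrow> \<bar>q i - p i\<bar> < e; \<And>i. i \<ge> n \<Longrightarrow> q i = 0\<rbrakk> \<Longrightarrow> q \<in> S"
proof -
  obtain T where T: "open T" "S = {x. \<forall>i\<ge>n. x i = 0} \<inter> T"
    using assms by (auto simp: Euclidean_space_eq openin_open)
  with assms have "p \<in> T" by auto
  from open_contains_box[OF T(1) this]
  obtain e where e: "e > 0" "\<And>q. (\<And>i. \<bar>q i - p i\<bar> < e) \<Longrightarrow> q \<in> T"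
    by metis
  show thesis
  proof
    show "e > 0" by fact
    fix q assume q: "\<And>i. i < n \<Longrightarrow> \<bar>q i - p i\<bar> < e" "\<And>i. i \<ge> n \<Longrightarrow> q i = 0"
    have "\<bar>q i - p i\<bar> < e" for i
      using q[of i] assms(2) T(2) e(1) by (cases "i < n") auto
    then show "q \<in> S" using e(2) T(2) q(2) by auto
  qed
qed

text \<open>Since i < n, moving coordinate i stays inside \<open>Euclidean_space n\<close>. This is
  why a partial derivative at a point of S depends only on the values on S.\<close>

lemma eventually_fun_upd_in:
  assumes "openin (Euclidean_space n) S" "a \<in> S" "i < n"
  shows "\<forall>\<^sub>F t in nhds (a i). a(i := t) \<in> S"
proof -
  obtain e where e: "e > 0"
    "\<And>q. \<lbrakk>\<And>i. i < n \<Longrightarrow> \<bar>q i - a i\<bar> < e; \<And>i. i \<ge> n \<Longrightarrow> q i = 0\<rbrakk> \<Longrightarrow> q \<in> S"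
    using openin_Euclidean_space_contains_box[OF assms(1,2)] by metis
  have "a(i := t) \<in> S" if "dist t (a i) < e" for t
    using that assms openin_Euclidean_space_subset[OF assms(1)] e(1)
    by (intro e(2)) (auto simp: dist_real_def)
  then show ?thesis
    using e(1) by (auto simp: eventually_nhds_metric)
qed

lemma partial_has_derivative_cong:
  assumes "openin (Euclidean_space n) S" "a \<in> S" "i < n" "\<And>x. x \<in> S \<Longrightarrow> g x = h x"
  shows "((\<lambda>t. g (a(i := t))) has_field_derivative D) (at (a i)) \<longleftrightarrow>
         ((\<lambda>t. h (a(i := t))) has_field_derivative D) (at (a i))"
  by (rule DERIV_cong_ev[OF refl _ refl])
     (use eventually_fun_upd_in[OF assms(1-3)] assms(4) in \<open>auto elim: eventually_mono\<close>)

text \<open>\<open>deriv\<close> is a choice among the numbers satisfying the derivative predicate.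
  The predicates for g and h coincide, hence so do the choices, even where no derivative
  exists.\<close>

lemma partial_deriv_cong:
  assumes "openin (Euclidean_space n) S" "a \<in> S" "i < n" "\<And>x. x \<in> S \<Longrightarrow> g x = h x"
  shows "partial_deriv i g a = partial_deriv i h a"
  unfolding partial_deriv_def deriv_def
  by (rule arg_cong[where f = Eps], rule ext, rule partial_has_derivative_cong[OF assms])

lemma C_k_on_cong:
  assumes "openin (Euclidean_space n) S" "\<And>x. x \<in> S \<Longrightarrow> g x = h x" "C_k_on k n S g"
  shows "C_k_on k n S h"
  using assms(2,3)
proof (induction k arbitrary: g h)
  case 0
  then show ?case
    by (auto simp: continuous_map_open_Euclidean_space_iff[OF assms(1)] cong: continuous_on_cong)
next
  case (Suc k)
  show ?case
    unfolding C_k_on.simps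
  proof (intro conjI allI impI ballI)
    show "continuous_map (subtopology (Euclidean_space n) S) euclideanreal h"
      using Suc.prems
      by (auto simp: continuous_map_open_Euclidean_space_iff[OF assms(1)] cong: continuous_on_cong)
  next
    fix i a assume i: "i < n" and a: "a \<in> S"
    then have "(\<lambda>t. g (a(i := t))) differentiable at (a i)"
      using Suc.prems(2) by simp
    then show "(\<lambda>t. h (a(i := t))) differentiable at (a i)"
      using partial_has_derivative_cong[where g = g and h = h, OF assms(1) a i Suc.prems(1)]
      unfolding real_differentiable_def by blast
  next
    fix i assume i: "i < n"
    then have "C_k_on k n S (partial_deriv i g)"
      using Suc.prems by simp
    then show "C_k_on k n S (partial_deriv i h)"
      by (rule Suc.IH[rotated]) (rule partial_deriv_cong[where g = g and h = h, OF assms(1) _ i Suc.prems(1)])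
  qed
qed

lemma C_k_on_imp_continuous_on:
  assumes "openin (Euclidean_space n) S" "C_k_on k n S g"
  shows "continuous_on S g"
  using assms by (cases k) (auto simp: continuous_map_open_Euclidean_space_iff)

lemma C_k_on_Suc_imp_C_k_on: "C_k_on (Suc k) n S g \<Longrightarrow> C_k_on k n S g"
  by (induction k arbitrary: g) auto

lemma C_k_on_Suc_partial_deriv:
  assumes "C_k_on (Suc k) n S g" "a \<in> S" "i < n"
  shows "((\<lambda>t. g (a(i := t))) has_field_derivative partial_deriv i g a) (at (a i))"
  using assms by (simp add: partial_deriv_def DERIV_deriv_iff_real_differentiable)

text \<open>Lets the regularity of the derivatives be checked on any explicit formula
  \<open>g'\<close>: by uniqueness of derivatives it agrees on S with \<open>partial_deriv\<close>,
  and \<open>C_k_on_cong\<close> transfers the property.\<close>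

lemma C_k_on_SucI:
  assumes S: "openin (Euclidean_space n) S" and "continuous_on S g"
    and D: "\<And>i a. \<lbrakk>i < n; a \<in> S\<rbrakk> \<Longrightarrow> ((\<lambda>t. g (a(i := t))) has_field_derivative g' i a) (at (a i))"
    and C: "\<And>i. i < n \<Longrightarrow> C_k_on k n S (g' i)"
  shows "C_k_on (Suc k) n S g"
  unfolding C_k_on.simps continuous_map_open_Euclidean_space_iff[OF S]
proof (intro conjI allI impI ballI)
  fix i a assume "i < n" "a \<in> S"
  then show "(\<lambda>t. g (a(i := t))) differentiable at (a i)"
    using D real_differentiable_def by blast
next
  fix i assume i: "i < n"
  show "C_k_on k n S (partial_deriv i g)"
    by (rule C_k_on_cong[OF S _ C[OF i]])
       (metis partial_deriv_def DERIV_imp_deriv D i)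
qed fact

section \<open>Constants, sums and products of C^k functions\<close>

lemma C_k_on_const:
  assumes S: "openin (Euclidean_space n) S"
  shows "C_k_on k n S (\<lambda>_. c)"
proof (induction k arbitrary: c)
  case (Suc k)
  show ?case
    by (rule C_k_on_SucI[OF S, where g' = "\<lambda>_ _. 0"]) (auto intro: Suc)
qed auto

lemma C_k_on_add:
  assumes S: "openin (Euclidean_space n) S"
  shows "\<lbrakk>C_k_on k n S g; C_k_on k n S h\<rbrakk> \<Longrightarrow> C_k_on k n S (\<lambda>x. g x + h x)"
proof (induction k arbitrary: g h)
  case (Suc k)
  have "continuous_on S g" "continuous_on S h"
    using C_k_on_imp_continuous_on[OF S] Suc.prems by blast+
  then show ?case
    using Suc
    by (intro C_k_on_SucI[OF S, where g' = "\<lambda>i x. partial_deriv i g x + partial_deriv i h x"]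
        continuous_on_add DERIV_add C_k_on_Suc_partial_deriv) auto
qed (auto intro: continuous_map_add)

lemma C_k_on_mult:
  assumes S: "openin (Euclidean_space n) S"
  shows "\<lbrakk>C_k_on k n S g; C_k_on k n S h\<rbrakk> \<Longrightarrow> C_k_on k n S (\<lambda>x. g x * h x)"
proof (induction k arbitrary: g h)
  case (Suc k)
  have "continuous_on S g" "continuous_on S h"
    using C_k_on_imp_continuous_on[OF S] Suc.prems by blast+
  show ?case
  proof (rule C_k_on_SucI[OF S,
        where g' = "\<lambda>i x. partial_deriv i g x * h x + partial_deriv i h x * g x"])
    show "continuous_on S (\<lambda>x. g x * h x)"
      by (rule continuous_on_mult) fact+
  next
    fix i a assume "i < n" "a \<in> S"
    then show "((\<lambda>t. g (a(i := t)) * h (a(i := t))) has_field_derivative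
        partial_deriv i g a * h a + partial_deriv i h a * g a) (at (a i))"
      using DERIV_mult[OF C_k_on_Suc_partial_deriv[OF Suc.prems(1), of a i]
          C_k_on_Suc_partial_deriv[OF Suc.prems(2), of a i]] by (simp only: fun_upd_triv)
  next
    fix i assume "i < n"
    then show "C_k_on k n S (\<lambda>x. partial_deriv i g x * h x + partial_deriv i h x * g x)"
      \<comment> \<open>Each Leibniz term pairs a derivative, which is C^k, with an undifferentiated
        factor, which is C^(k+1) and has to be weakened to C^k.\<close>
      using Suc.prems C_k_on_Suc_imp_C_k_on by (intro C_k_on_add[OF S] Suc.IH) auto
  qed
qed (auto intro: continuous_map_real_mult)

lemma C_k_on_sum:
  assumes S: "openin (Euclidean_space n) S" and "\<And>j. j \<in> J \<Longrightarrow> C_k_on k n S (g j)"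
  shows "C_k_on k n S (\<lambda>x. \<Sum>j\<in>J. g j x)"
  using assms(2)
  by (induction J rule: infinite_finite_induct) (simp_all add: C_k_on_add C_k_on_const S)

section \<open>Restriction and locality of the C^k condition\<close>

lemma C_k_on_subset:
  assumes "T \<subseteq> S"
  shows "C_k_on k n S g \<Longrightarrow> C_k_on k n T g"
proof (induction k arbitrary: g)
  case (Suc k)
  then show ?case
    using assms by (auto intro: continuous_map_from_subtopology_mono)
qed (use assms in \<open>auto intro: continuous_map_from_subtopology_mono\<close>)

text \<open>Derivatives are pointwise and \<open>partial_deriv\<close> does not mention the domain,
  so only continuity has to be glued. The lemma serves composition of smooth maps, where the
  intermediate chart changes from point to point.\<close>

lemma C_k_on_local:
  assumes "\<And>a. a \<in> S \<Longrightarrow> \<exists>T. openin (Euclidean_space n) T \<and> a \<in> T \<and> T \<subseteq> S \<and> C_k_on k n T g"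
  shows "C_k_on k n S g"
proof -
  have S: "openin (Euclidean_space n) S"
    by (subst openin_subopen) (use assms in meson)
  have cont: "continuous_on S g"
    if "\<And>a. a \<in> S \<Longrightarrow> \<exists>T. openin (Euclidean_space n) T \<and> a \<in> T \<and> T \<subseteq> S \<and> continuous_on T g"
    for g :: "(nat \<Rightarrow> real) \<Rightarrow> real"
  proof -
    \<comment> \<open>The cover consists of all open pieces on which g is continuous; pasting the
      single function g makes agreement on overlaps trivial.\<close>
    let ?F = "{T. openin (Euclidean_space n) T \<and> T \<subseteq> S \<and> continuous_on T g}"
    have "continuous_map (top_of_set S) euclideanreal g"
    proof (rule pasting_lemma[where I = ?F and T = "\<lambda>T. T" and f = "\<lambda>_. g"])
      fix T assume T: "T \<in> ?F"
      then show "openin (top_of_set S) T"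
        using openin_Euclidean_space_subset[OF S]
        by (auto simp: Euclidean_space_eq intro: openin_subset_trans)
      show "continuous_map (subtopology (top_of_set S) T) euclideanreal g"
        using T by (simp add: subtopology_subtopology Int_absorb1)
    qed (use that in auto)
    then show ?thesis by simp
  qed
  show ?thesis
    using assms
  proof (induction k arbitrary: g)
    case 0
    have "continuous_on S g"
    proof (rule cont)
      fix a assume "a \<in> S"
      from 0[OF this] C_k_on_imp_continuous_on
      show "\<exists>T. openin (Euclidean_space n) T \<and> a \<in> T \<and> T \<subseteq> S \<and> continuous_on T g"
        by metis
    qed
    then show ?case by (simp add: continuous_map_open_Euclidean_space_iff[OF S])
  next
    case (Suc k)
    have "continuous_on S g"
    proof (rule cont)
      fix a assume "a \<in> S"
      from Suc.prems[OF this] C_k_on_imp_continuous_on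
      show "\<exists>T. openin (Euclidean_space n) T \<and> a \<in> T \<and> T \<subseteq> S \<and> continuous_on T g"
        by metis
    qed
    then show ?case
    proof (rule C_k_on_SucI[OF S, where g' = "\<lambda>i. partial_deriv i g"])
      fix i a assume i: "i < n" and "a \<in> S"
      from Suc.prems[OF \<open>a \<in> S\<close>] obtain T where "a \<in> T" "C_k_on (Suc k) n T g"
        by metis
      then show "((\<lambda>t. g (a(i := t))) has_field_derivative partial_deriv i g a) (at (a i))"
        using C_k_on_Suc_partial_deriv i by metis
    next
      fix i assume i: "i < n"
      show "C_k_on k n S (partial_deriv i g)"
      proof (rule Suc.IH)
        fix a assume "a \<in> S"
        from Suc.prems[OF this] i
        show "\<exists>T. openin (Euclidean_space n) T \<and> a \<in> T \<and> T \<subseteq> S \<and> C_k_on k n T (partial_deriv i g)"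
          by (metis C_k_on.simps(2))
      qed
    qed
  qed
qed

section \<open>The chain rule\<close>

lemma mvt_unordered:
  fixes \<phi> :: "real \<Rightarrow> real"
  assumes "\<And>s. \<bar>s - a\<bar> \<le> \<bar>b - a\<bar> \<Longrightarrow> (\<phi> has_field_derivative \<phi>' s) (at s)"
  shows "\<exists>s. \<bar>s - a\<bar> \<le> \<bar>b - a\<bar> \<and> \<phi> b - \<phi> a = (b - a) * \<phi>' s"
\<comment> \<open>A curve coordinate may move up, down or not at all. The bound on s by distance
  from a covers all three cases and matches the symmetric boxes inside open sets.\<close>
proof (rule linorder_cases[of a b])
  assume "a < b"
  then have "\<exists>z>a. z < b \<and> \<phi> b - \<phi> a = (b - a) * \<phi>' z"
    by (intro MVT2) (auto intro!: assms)
  then show ?thesis by force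
next
  assume "b < a"
  then have "\<exists>z>b. z < a \<and> \<phi> a - \<phi> b = (a - b) * \<phi>' z"
    by (intro MVT2) (auto intro!: assms)
  then obtain z where "b < z" "z < a" "\<phi> a - \<phi> b = (a - b) * \<phi>' z" by blast
  then show ?thesis by (intro exI[of _ z]) (auto simp: algebra_simps)
qed auto

lemma tendsto_fun_iff:
  fixes f :: "'a \<Rightarrow> 'i \<Rightarrow> 'b::topological_space"
  shows "(f \<longlongrightarrow> l) F \<longleftrightarrow> (\<forall>i. ((\<lambda>x. f x i) \<longlongrightarrow> l i) F)"
  using limitin_componentwise[of "\<lambda>_. euclidean" UNIV f l F]
  by (simp add: euclidean_product_topology)

text \<open>The increment of g from \<open>\<gamma> t0\<close> to \<open>\<gamma> t\<close>
  telescopes over single-coordinate moves. Each move contributes a coordinate increment times a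
  partial derivative at an intermediate point; these points tend to \<open>\<gamma> t0\<close>,
  where continuity of the partial derivatives gives the limit.\<close>

lemma chain_rule_along_curve:
  fixes g :: "(nat \<Rightarrow> real) \<Rightarrow> real" and \<gamma> :: "real \<Rightarrow> nat \<Rightarrow> real"
  assumes S: "openin (Euclidean_space m) S" and p: "\<gamma> t0 \<in> S"
    and dg: "\<And>j a. \<lbrakk>j < m; a \<in> S\<rbrakk> \<Longrightarrow> ((\<lambda>t. g (a(j := t))) has_field_derivative partial_deriv j g a) (at (a j))"
    and cg: "\<And>j. j < m \<Longrightarrow> continuous_on S (partial_deriv j g)"
    and d\<gamma>: "\<And>j. j < m \<Longrightarrow> ((\<lambda>t. \<gamma> t j) has_field_derivative d j) (at t0)"
    and ev: "\<forall>\<^sub>F t in nhds t0. \<gamma> t \<in> S"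
  shows "((\<lambda>t. g (\<gamma> t)) has_field_derivative (\<Sum>j<m. partial_deriv j g (\<gamma> t0) * d j)) (at t0)"
proof -
  \<comment> \<open>The intermediate corners: the first r coordinates have already moved.
    \<open>q 0 t\<close> is constantly \<open>\<gamma> t0\<close>, and \<open>q m t\<close> is
    \<open>\<gamma> t\<close> whenever the latter lies in S.\<close>
  define q where "q r t i = (if i < r then \<gamma> t i else \<gamma> t0 i)" for r t i
  have q_t0: "q r t0 = \<gamma> t0" for r
    by (auto simp: q_def)
  have out: "a i = 0" if "a \<in> S" "i \<ge> m" for a i
    using that openin_Euclidean_space_subset[OF S] by auto
  obtain e where e: "e > 0"
    "\<And>a. \<lbrakk>\<And>i. i < m \<Longrightarrow> \<bar>a i - \<gamma> t0 i\<bar> < e; \<And>i. i \<ge> m \<Longrightarrow> a i = 0\<rbrakk> \<Longrightarrow> a \<in> S"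
    using openin_Euclidean_space_contains_box[OF S p] by metis
  have lim: "(\<lambda>t. \<gamma> t j) \<midarrow>t0\<rightarrow> \<gamma> t0 j" if "j < m" for j
    using DERIV_isCont[OF d\<gamma>[OF that]] by (simp add: isCont_def)
  have near: "\<forall>\<^sub>F t in at t0. \<forall>j<m. \<bar>\<gamma> t j - \<gamma> t0 j\<bar> < e"
  proof -
    have "\<forall>\<^sub>F t in at t0. \<forall>j\<in>{..<m}. dist (\<gamma> t j) (\<gamma> t0 j) < e"
      by (intro eventually_ball_finite ballI tendstoD lim e(1)) auto
    then show ?thesis
      by (auto simp: dist_real_def elim: eventually_mono)
  qed
  have "((\<lambda>t. g (q r t)) has_field_derivative (\<Sum>j<r. partial_deriv j g (\<gamma> t0) * d j)) (at t0)"
    if "r \<le> m" for r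
    using that
  proof (induction r)
    case 0
    then show ?case by (simp add: q_def)
  next
    case (Suc r)
    then have r: "r < m" by simp
    have q_r: "q r t = (q r t)(r := \<gamma> t0 r)" and q_Suc: "q (Suc r) t = (q r t)(r := \<gamma> t r)" for t
      by (auto simp: q_def)
    \<comment> \<open>What is kept about a mean value point s: its distance bound, membership of the
      altered corner in S, and the increment formula.\<close>
    let ?P = "\<lambda>t s. \<bar>s - \<gamma> t0 r\<bar> \<le> \<bar>\<gamma> t r - \<gamma> t0 r\<bar> \<and> (q r t)(r := s) \<in> S \<and>
      g (q (Suc r) t) - g (q r t) = (\<gamma> t r - \<gamma> t0 r) * partial_deriv r g ((q r t)(r := s))"
    have "\<exists>s. ?P t s" if t: "\<forall>j<m. \<bar>\<gamma> t j - \<gamma> t0 j\<bar> < e" for t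
    proof -
      have inS: "(q r t)(r := s) \<in> S" if "\<bar>s - \<gamma> t0 r\<bar> \<le> \<bar>\<gamma> t r - \<gamma> t0 r\<bar>" for s
      proof (rule e(2))
        show "\<bar>((q r t)(r := s)) i - \<gamma> t0 i\<bar> < e" if "i < m" for i
          using t that r e(1) \<open>\<bar>s - \<gamma> t0 r\<bar> \<le> _\<close> by (fastforce simp: q_def)
        show "((q r t)(r := s)) i = 0" if "i \<ge> m" for i
          using that r out[OF p] by (auto simp: q_def)
      qed
      have "\<exists>s. \<bar>s - \<gamma> t0 r\<bar> \<le> \<bar>\<gamma> t r - \<gamma> t0 r\<bar> \<and> g ((q r t)(r := \<gamma> t r)) - g ((q r t)(r := \<gamma> t0 r))
          = (\<gamma> t r - \<gamma> t0 r) * partial_deriv r g ((q r t)(r := s))"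
      proof (rule mvt_unordered)
        fix s assume "\<bar>s - \<gamma> t0 r\<bar> \<le> \<bar>\<gamma> t r - \<gamma> t0 r\<bar>"
        from dg[OF r inS[OF this]]
        show "((\<lambda>s. g ((q r t)(r := s))) has_field_derivative partial_deriv r g ((q r t)(r := s))) (at s)"
          by simp
      qed
      then show ?thesis
        using inS q_r[of t] q_Suc[of t] by metis
    qed
    \<comment> \<open>The mean value point is chosen separately for each t; its convergence comes
      from the distance bound alone, without regularity of the choice.\<close>
    then obtain \<sigma> where \<sigma>: "\<And>t. \<forall>j<m. \<bar>\<gamma> t j - \<gamma> t0 j\<bar> < e \<Longrightarrow> ?P t (\<sigma> t)"
      by metis
    from near have ev\<sigma>: "\<forall>\<^sub>F t in at t0. ?P t (\<sigma> t)"
      by (rule eventually_mono) (rule \<sigma>)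
    have "(\<lambda>t. \<sigma> t - \<gamma> t0 r) \<midarrow>t0\<rightarrow> 0"
    proof (rule Lim_null_comparison)
      show "\<forall>\<^sub>F t in at t0. norm (\<sigma> t - \<gamma> t0 r) \<le> \<bar>\<gamma> t r - \<gamma> t0 r\<bar>"
        using ev\<sigma> by (auto elim: eventually_mono)
      show "(\<lambda>t. \<bar>\<gamma> t r - \<gamma> t0 r\<bar>) \<midarrow>t0\<rightarrow> 0"
        using lim[OF r] LIM_zero tendsto_rabs_zero by blast
    qed
    then have lim\<sigma>: "\<sigma> \<midarrow>t0\<rightarrow> \<gamma> t0 r"
      by (simp add: LIM_zero_iff)
    have "(\<lambda>t. ((q r t)(r := \<sigma> t)) i) \<midarrow>t0\<rightarrow> \<gamma> t0 i" for i
    proof (cases "i < r")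
      case True
      then show ?thesis using lim[of i] r by (simp add: q_def)
    next
      case False
      then show ?thesis using lim\<sigma> by (cases "i = r") (simp_all add: q_def)
    qed
    then have "(\<lambda>t. (q r t)(r := \<sigma> t)) \<midarrow>t0\<rightarrow> \<gamma> t0"
      unfolding tendsto_fun_iff by blast
    then have limK: "(\<lambda>t. partial_deriv r g ((q r t)(r := \<sigma> t))) \<midarrow>t0\<rightarrow> partial_deriv r g (\<gamma> t0)"
      by (rule continuous_on_tendsto_compose[OF cg[OF r] _ p])
         (use ev\<sigma> in \<open>auto elim: eventually_mono\<close>)
    have "(\<lambda>t. (\<gamma> t r - \<gamma> t0 r) / (t - t0)) \<midarrow>t0\<rightarrow> d r"
      using d\<gamma>[OF r] by (simp add: has_field_derivative_iff)
    from tendsto_mult[OF limK this]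
    \<comment> \<open>This is the difference quotient of the r-th increment; at \<open>t0\<close>
      both corners equal \<open>\<gamma> t0\<close>, so the subtracted value is 0.\<close>
    have "(\<lambda>t. ((g (q (Suc r) t) - g (q r t)) - (g (q (Suc r) t0) - g (q r t0))) / (t - t0))
        \<midarrow>t0\<rightarrow> partial_deriv r g (\<gamma> t0) * d r"
      by (rule Lim_transform_eventually) (use ev\<sigma> in \<open>auto simp: q_t0 elim!: eventually_mono\<close>)
    then have "((\<lambda>t. g (q (Suc r) t) - g (q r t)) has_field_derivative partial_deriv r g (\<gamma> t0) * d r) (at t0)"
      by (simp add: has_field_derivative_iff)
    from DERIV_add[OF Suc.IH this] r show ?case
      by simp
  qed
  from this[of m] have m: "((\<lambda>t. g (q m t)) has_field_derivative (\<Sum>j<m. partial_deriv j g (\<gamma> t0) * d j)) (at t0)"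
    by simp
  have ev_eq: "\<forall>\<^sub>F t in nhds t0. g (q m t) = g (\<gamma> t)"
  proof -
    \<comment> \<open>Coordinates from m on are taken from \<open>\<gamma> t0\<close> in
      \<open>q m t\<close>; they agree with those of \<open>\<gamma> t\<close> because both points
      lie in S and vanish there.\<close>
    have "q m t = \<gamma> t" if "\<gamma> t \<in> S" for t
      using out[OF that] out[OF p] by (auto simp: q_def not_less)
    then show ?thesis using ev by (auto elim: eventually_mono)
  qed
  show ?thesis
    by (rule iffD1[OF DERIV_cong_ev[OF refl ev_eq refl] m])
qed

text \<open>The partial derivatives of g \<circ> F are sums of products of (\<partial>_j g) \<circ>
  F and \<partial>_i F_j. The induction varies g and keeps F fixed: \<partial>_j g loses one order,
  and the components of F are weakened to match.\<close>

lemma C_k_on_compose: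
  fixes F :: "(nat \<Rightarrow> real) \<Rightarrow> nat \<Rightarrow> real"
  assumes S: "openin (Euclidean_space n) S" and T: "openin (Euclidean_space m) T"
    and ST: "\<And>x. x \<in> S \<Longrightarrow> F x \<in> T"
  shows "\<lbrakk>C_k_on k m T g; \<And>j. j < m \<Longrightarrow> C_k_on k n S (\<lambda>x. F x j)\<rbrakk> \<Longrightarrow> C_k_on k n S (\<lambda>x. g (F x))"
proof -
  have cont: "continuous_on S (\<lambda>x. g (F x))"
    if g: "C_k_on k m T g" and F: "\<And>j. j < m \<Longrightarrow> C_k_on k n S (\<lambda>x. F x j)" for k g
  proof -
    have "continuous_on S (\<lambda>x. F x j)" for j
    proof (cases "j < m")
      case True
      then show ?thesis using F C_k_on_imp_continuous_on[OF S] by blast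
    next
      case False
      \<comment> \<open>The C^k hypothesis concerns only the components j < m; the others vanish
        because F maps S into T.\<close>
      then have "F x j = 0" if "x \<in> S" for x
        using ST[OF that] openin_Euclidean_space_subset[OF T] by auto
      then show ?thesis by (simp cong: continuous_on_cong)
    qed
    then have "continuous_on S F"
      by (rule continuous_on_coordinatewise_then_product)
    then show ?thesis
      by (rule continuous_on_compose2[OF C_k_on_imp_continuous_on[OF T g]]) (use ST in auto)
  qed
  show "\<lbrakk>C_k_on k m T g; \<And>j. j < m \<Longrightarrow> C_k_on k n S (\<lambda>x. F x j)\<rbrakk> \<Longrightarrow> C_k_on k n S (\<lambda>x. g (F x))"
  proof (induction k arbitrary: g)
    case 0
    then show ?case
      using cont[of 0 g] by (simp add: continuous_map_open_Euclidean_space_iff S)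
  next
    case (Suc k)
    have dF: "((\<lambda>t. F (a(i := t)) j) has_field_derivative partial_deriv i (\<lambda>x. F x j) a) (at (a i))"
      if "i < n" "a \<in> S" "j < m" for i a j
      using C_k_on_Suc_partial_deriv[OF Suc.prems(2)[OF that(3)] that(2,1)] .
    show ?case
    proof (rule C_k_on_SucI[OF S,
          where g' = "\<lambda>i x. \<Sum>j<m. partial_deriv j g (F x) * partial_deriv i (\<lambda>x. F x j) x"])
      show "continuous_on S (\<lambda>x. g (F x))"
        by (rule cont) (use Suc.prems in blast)+
    next
      fix i a assume i: "i < n" and a: "a \<in> S"
      \<comment> \<open>Writing \<open>F (a(i := a i))\<close> for \<open>F a\<close> exhibits the
        base point as the value of the curve at parameter \<open>a i\<close>, as the chain rule
        expects.\<close>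
      have "((\<lambda>t. g (F (a(i := t)))) has_field_derivative
          (\<Sum>j<m. partial_deriv j g (F (a(i := a i))) * partial_deriv i (\<lambda>x. F x j) a)) (at (a i))"
      proof (rule chain_rule_along_curve[OF T])
        show "F (a(i := a i)) \<in> T"
          using ST[OF a] by simp
        show "continuous_on T (partial_deriv j g)" if "j < m" for j
          using Suc.prems(1) that C_k_on_imp_continuous_on[OF T] by auto
        show "\<forall>\<^sub>F t in nhds (a i). F (a(i := t)) \<in> T"
          using eventually_fun_upd_in[OF S a i] by (rule eventually_mono) (rule ST)
      qed (fact dF[OF i a] | rule C_k_on_Suc_partial_deriv[OF Suc.prems(1)], assumption+)+
      then show "((\<lambda>t. g (F (a(i := t)))) has_field_derivative
          (\<Sum>j<m. partial_deriv j g (F a) * partial_deriv i (\<lambda>x. F x j) a)) (at (a i))"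
        by (simp only: fun_upd_triv)
    next
      fix i assume i: "i < n"
      have "C_k_on k n S (\<lambda>x. partial_deriv j g (F x))" if "j < m" for j
      proof (rule Suc.IH)
        show "C_k_on k m T (partial_deriv j g)"
          using Suc.prems(1) that by simp
        show "C_k_on k n S (\<lambda>x. F x j)" if "j < m" for j
          using Suc.prems(2)[OF that] by (rule C_k_on_Suc_imp_C_k_on)
      qed
      then show "C_k_on k n S (\<lambda>x. \<Sum>j<m. partial_deriv j g (F x) * partial_deriv i (\<lambda>x. F x j) x)"
        using Suc.prems(2) i by (intro C_k_on_sum[OF S] C_k_on_mult[OF S]) auto
    qed
  qed
qed

section \<open>Composition of smooth maps\<close>

lemma smooth_fun_cong:
  assumes "openin (Euclidean_space n) S" "\<And>x. x \<in> S \<Longrightarrow> F x = G x" "smooth_fun n m S F"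
  shows "smooth_fun n m S G"
  unfolding smooth_fun_def
proof (intro allI impI)
  fix j k assume "j < m"
  with assms(3) have "C_k_on k n S (\<lambda>a. F a j)" by (simp add: smooth_fun_def)
  then show "C_k_on k n S (\<lambda>a. G a j)"
    by (rule C_k_on_cong[OF assms(1), rotated]) (simp add: assms(2))
qed

lemma smooth_fun_subset: "\<lbrakk>smooth_fun n m S F; T \<subseteq> S\<rbrakk> \<Longrightarrow> smooth_fun n m T F"
  by (auto simp: smooth_fun_def intro: C_k_on_subset)

lemma smooth_fun_local:
  assumes "\<And>a. a \<in> S \<Longrightarrow>
    \<exists>T. openin (Euclidean_space n) T \<and> a \<in> T \<and> T \<subseteq> S \<and> smooth_fun n m T F"
  shows "smooth_fun n m S F"
  unfolding smooth_fun_def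
proof (intro allI impI C_k_on_local)
  fix j k a assume "j < m" "a \<in> S"
  then show "\<exists>T. openin (Euclidean_space n) T \<and> a \<in> T \<and> T \<subseteq> S \<and> C_k_on k n T (\<lambda>a. F a j)"
    using assms[OF \<open>a \<in> S\<close>] unfolding smooth_fun_def by metis
qed

lemma smooth_fun_compose:
  assumes "openin (Euclidean_space n) S" "openin (Euclidean_space m) T"
    "\<And>x. x \<in> S \<Longrightarrow> F x \<in> T" "smooth_fun n m S F" "smooth_fun m l T G"
  shows "smooth_fun n l S (G \<circ> F)"
  unfolding smooth_fun_def
proof (intro allI impI)
  fix j k assume "j < l"
  show "C_k_on k n S (\<lambda>a. (G \<circ> F) a j)"
    using C_k_on_compose[OF assms(1-3), where g = "\<lambda>a. G a j" and k = k] assms(4,5) \<open>j < l\<close>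
    by (simp add: smooth_fun_def)
qed

section \<open>Charts and their domains\<close>

lemma is_chart_open_image:
  assumes "is_chart X n (U, x)" "openin X A" "A \<subseteq> U"
  shows "openin (Euclidean_space n) (x ` A)"
proof -
  have "openin (subtopology X U) A"
    using assms by (auto simp: is_chart_def openin_open_subtopology)
  then have "openin (subtopology (Euclidean_space n) (x ` U)) (x ` A)"
    using assms(1) homeomorphic_imp_open_map by (auto simp: is_chart_def open_map_def)
  then show ?thesis
    using assms(1) by (auto simp: is_chart_def intro: openin_trans_full)
qed

lemma is_chart_inv_into [simp]:
  assumes "is_chart X n (U, x)" "p \<in> U"
  shows "inv_into U x (x p) = p"
proof -
  have "topspace X \<inter> U = U"
    using assms(1) openin_subset[of X U] by (auto simp: is_chart_def)
  then have "inj_on x U"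
    using assms(1) homeomorphic_imp_injective_map by (fastforce simp: is_chart_def)
  then show ?thesis using assms(2) by simp
qed

lemma smooth_manifold_chart:
  "\<lbrakk>smooth_manifold M; \<kappa> \<in> atlas M\<rbrakk> \<Longrightarrow> is_chart (mtop M) (mdim M) \<kappa>"
  by (simp add: smooth_manifold_def)

lemma smooth_manifold_chart_around:
  assumes "smooth_manifold M" "p \<in> points M"
  obtains U x where "(U, x) \<in> atlas M" "p \<in> U"
proof -
  from assms have "\<exists>(U, x)\<in>atlas M. p \<in> U"
    by (simp add: smooth_manifold_def)
  then show thesis using that by blast
qed

lemma smooth_manifold_transition:
  "\<lbrakk>smooth_manifold M; \<kappa> \<in> atlas M; \<mu> \<in> atlas M\<rbrakk> \<Longrightarrow> smooth_transition (mdim M) \<kappa> \<mu>"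
  by (simp add: smooth_manifold_def compatible_def)

lemma is_chart_open: "is_chart X n (U, x) \<Longrightarrow> openin X U"
  by (simp add: is_chart_def)

lemma openin_chart_preimage:
  assumes "openin X U" "continuous_map X Y f" "openin Y V"
  shows "openin X {p \<in> U. f p \<in> V}"
proof -
  have "{p \<in> U. f p \<in> V} = U \<inter> {p \<in> topspace X. f p \<in> V}"
    using openin_subset[OF assms(1)] by auto
  then show ?thesis
    using assms openin_continuous_map_preimage by fastforce
qed

section \<open>Smooth maps between manifolds\<close>

lemma smooth_mapI:
  assumes "continuous_map (mtop M) (mtop N) f"
    and "\<And>U x V y. \<lbrakk>(U, x) \<in> atlas M; (V, y) \<in> atlas N\<rbrakk> \<Longrightarrow>
      smooth_fun (mdim M) (mdim N) (x ` {p \<in> U. f p \<in> V}) (coord_rep f (U, x) (V, y))"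
  shows "smooth_map M N f"
  using assms by (auto simp: smooth_map_def)

lemma smooth_map_in_points: "\<lbrakk>smooth_map M N f; p \<in> points M\<rbrakk> \<Longrightarrow> f p \<in> points N"
  by (auto simp: smooth_map_def points_def continuous_map_def)

text \<open>Needed because identities and composites of arrows are extensional versions of the
  honest maps and agree with them only on points.\<close>

lemma smooth_map_cong:
  assumes M: "smooth_manifold M" and N: "smooth_manifold N"
    and f: "smooth_map M N f" and eq: "\<And>p. p \<in> points M \<Longrightarrow> f p = g p"
  shows "smooth_map M N g"
proof (rule smooth_mapI, goal_cases)
  case 1
  show ?case
    using f eq by (auto simp: smooth_map_def points_def intro: continuous_map_eq)
next
  case (2 U x V y)
  have Ux: "is_chart (mtop M) (mdim M) (U, x)" and Vy: "is_chart (mtop N) (mdim N) (V, y)"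
    using 2 M N by (auto intro: smooth_manifold_chart)
  have U: "U \<subseteq> points M"
    using openin_subset[OF is_chart_open[OF Ux]] by (simp add: points_def)
  let ?A = "{p \<in> U. f p \<in> V}"
  have A: "{p \<in> U. g p \<in> V} = ?A"
    using eq U by auto
  have "openin (Euclidean_space (mdim M)) (x ` ?A)"
    using f is_chart_open[OF Ux] is_chart_open[OF Vy]
    by (intro is_chart_open_image[OF Ux] openin_chart_preimage) (auto simp: smooth_map_def)
  then have "smooth_fun (mdim M) (mdim N) (x ` ?A) (coord_rep g (U, x) (V, y))"
  proof (rule smooth_fun_cong)
    show "smooth_fun (mdim M) (mdim N) (x ` ?A) (coord_rep f (U, x) (V, y))"
      using f 2 by (auto simp: smooth_map_def)
    show "coord_rep f (U, x) (V, y) a = coord_rep g (U, x) (V, y) a" if "a \<in> x ` ?A" for a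
      using that eq U Ux by (auto simp: coord_rep_def)
  qed
  then show ?case by (simp add: A)
qed

text \<open>Around a point p a chart V of N at f p is inserted. Where f lands in V, the intermediate
  chart cancels against its inverse, and the coordinate representation of the composite is the
  composite of the two representations.\<close>

lemma smooth_map_compose:
  assumes M: "smooth_manifold M" and N: "smooth_manifold N" and P: "smooth_manifold P"
    and f: "smooth_map M N f" and g: "smooth_map N P g"
  shows "smooth_map M P (g \<circ> f)"
proof (rule smooth_mapI, goal_cases)
  case 1
  show ?case
    using f g by (auto simp: smooth_map_def intro: continuous_map_compose)
next
  case (2 U x W z)
  have Ux: "is_chart (mtop M) (mdim M) (U, x)" and Wz: "is_chart (mtop P) (mdim P) (W, z)"
    using 2 M P by (auto intro: smooth_manifold_chart)
  have cf: "continuous_map (mtop M) (mtop N) f" and cg: "continuous_map (mtop N) (mtop P) g"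
    using f g by (auto simp: smooth_map_def)
  show ?case
  proof (rule smooth_fun_local)
    fix a assume "a \<in> x ` {p \<in> U. (g \<circ> f) p \<in> W}"
    then obtain p where p: "p \<in> U" "g (f p) \<in> W" "a = x p" by auto
    have "p \<in> points M"
      using p(1) openin_subset[OF is_chart_open[OF Ux]] by (auto simp: points_def)
    then have "f p \<in> points N"
      by (rule smooth_map_in_points[OF f])
    then obtain V y where Vy': "(V, y) \<in> atlas N" "f p \<in> V"
      by (rule smooth_manifold_chart_around[OF N])
    then have Vy: "is_chart (mtop N) (mdim N) (V, y)"
      using N by (auto intro: smooth_manifold_chart)
    \<comment> \<open>\<open>?B\<close> is where the representation of g in V and W makes sense, and
      \<open>?A\<close> is the part of U that f sends there. Both are open by continuity.\<close>
    let ?B = "{q \<in> V. g q \<in> W}"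
    let ?A = "{p \<in> U. f p \<in> ?B}"
    let ?F = "coord_rep f (U, x) (V, y)" and ?G = "coord_rep g (V, y) (W, z)"
    have B: "openin (mtop N) ?B"
      using is_chart_open[OF Vy] is_chart_open[OF Wz] cg by (intro openin_chart_preimage)
    have A: "openin (mtop M) ?A"
      using is_chart_open[OF Ux] cf B by (rule openin_chart_preimage)
    have xA: "openin (Euclidean_space (mdim M)) (x ` ?A)"
      by (rule is_chart_open_image[OF Ux A]) auto
    have "smooth_fun (mdim M) (mdim P) (x ` ?A) (?G \<circ> ?F)"
    proof (rule smooth_fun_compose[OF xA])
      show "openin (Euclidean_space (mdim N)) (y ` ?B)"
        by (rule is_chart_open_image[OF Vy B]) auto
      show "?F b \<in> y ` ?B" if "b \<in> x ` ?A" for b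
        using that Ux by (auto simp: coord_rep_def)
      have "smooth_fun (mdim M) (mdim N) (x ` {p \<in> U. f p \<in> V}) ?F"
        using f 2 Vy' by (auto simp: smooth_map_def)
      then show "smooth_fun (mdim M) (mdim N) (x ` ?A) ?F"
        by (rule smooth_fun_subset) auto
      show "smooth_fun (mdim N) (mdim P) (y ` ?B) ?G"
        using g 2 Vy' by (auto simp: smooth_map_def)
    qed
    then have "smooth_fun (mdim M) (mdim P) (x ` ?A) (coord_rep (g \<circ> f) (U, x) (W, z))"
      by (rule smooth_fun_cong[OF xA, rotated]) (use Ux Vy in \<open>auto simp: coord_rep_def\<close>)
    with xA p Vy' show "\<exists>T. openin (Euclidean_space (mdim M)) T \<and> a \<in> T \<and>
        T \<subseteq> x ` {p \<in> U. (g \<circ> f) p \<in> W} \<and>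
        smooth_fun (mdim M) (mdim P) T (coord_rep (g \<circ> f) (U, x) (W, z))"
      by (intro exI[of _ "x ` ?A"]) auto
  qed
qed

text \<open>In charts the identity is a transition map, so this is the compatibility of the
  atlas.\<close>

lemma smooth_map_id:
  assumes "smooth_manifold M"
  shows "smooth_map M M id"
proof (rule smooth_mapI, goal_cases)
  case (2 U x V y)
  then have "smooth_transition (mdim M) (U, x) (V, y)"
    by (rule smooth_manifold_transition[OF assms])
  then show ?case
    by (simp add: smooth_transition_def coord_rep_def Int_def)
qed simp

lemma smooth_map_restrict_id: "smooth_manifold M \<Longrightarrow> smooth_map M M (restrict id (points M))"
  by (rule smooth_map_cong[OF _ _ smooth_map_id]) auto

lemma smooth_map_compose_on_points:
  assumes "smooth_manifold M" "smooth_manifold N" "smooth_manifold P"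
    "smooth_map M N f" "smooth_map N P g"
  shows "smooth_map M P (compose (points M) g f)"
  by (rule smooth_map_cong[OF assms(1,3) smooth_map_compose[OF assms]]) (simp add: compose_eq)

section \<open>The functors induced by \<open>f\<close>\<close>

lemma is_morphism_ident:
  assumes "smooth_factorization M N u X"
  shows "is_morphism M X (restrict id (points (phase X))) X"
  using assms smooth_map_in_points[of M "phase X" "inner X"]
  by (auto simp: is_morphism_def smooth_factorization_def smooth_map_restrict_id)

lemma is_morphism_compose:
  assumes "smooth_factorization M N u X" "smooth_factorization M N u Y" "smooth_factorization M N u Z"
    and c: "is_morphism M X c Y" and d: "is_morphism M Y d Z"
  shows "is_morphism M X (compose (points (phase X)) d c) Z"
proof -
  have "c q \<in> points (phase Y)" if "q \<in> points (phase X)" for q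
    using c that smooth_map_in_points unfolding is_morphism_def by metis
  moreover have "inner X p \<in> points (phase X)" if "p \<in> points M" for p
    using assms(1) that smooth_map_in_points unfolding smooth_factorization_def by metis
  moreover have "smooth_map (phase X) (phase Z) (compose (points (phase X)) d c)"
    using assms by (intro smooth_map_compose_on_points[where N = "phase Y"])
      (auto simp: is_morphism_def smooth_factorization_def)
  ultimately show ?thesis
    using c d by (auto simp: is_morphism_def compose_eq)
qed

lemma category_factorization_cat:
  assumes F: "\<And>X. X \<in> F \<Longrightarrow> smooth_factorization M N u X"
  shows "category (factorization_cat M F)"
proof
  fix g h assume "g \<in> Arrs (factorization_cat M F)" "h \<in> Arrs (factorization_cat M F)"
    "Src (factorization_cat M F) h = Tgt (factorization_cat M F) g"
  then show "Cmp (factorization_cat M F) h g \<in> Arrs (factorization_cat M F)"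
    using F by (auto simp: factorization_cat_def intro: is_morphism_compose)
next
  fix g assume "g \<in> Arrs (factorization_cat M F)"
  then show "Cmp (factorization_cat M F) g (Ident (factorization_cat M F) (Src (factorization_cat M F) g)) = g"
    by (auto simp: factorization_cat_def is_morphism_def compose_def extensional_def fun_eq_iff)
next
  fix g assume "g \<in> Arrs (factorization_cat M F)"
  then obtain X c Y where g: "g = (X, c, Y)" and c: "is_morphism M X c Y"
    by (auto simp: factorization_cat_def)
  \<comment> \<open>The identity arrow of Y acts as the identity only on points of its phase space,
    so the left identity law needs c to land there.\<close>
  have "c q \<in> points (phase Y)" if "q \<in> points (phase X)" for q
    using c that smooth_map_in_points unfolding is_morphism_def by metis
  then show "Cmp (factorization_cat M F) (Ident (factorization_cat M F) (Tgt (factorization_cat M F) g)) g = g"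
    using c by (auto simp: g factorization_cat_def is_morphism_def compose_def extensional_def fun_eq_iff)
next
  fix g h k assume "g \<in> Arrs (factorization_cat M F)" "h \<in> Arrs (factorization_cat M F)"
    "k \<in> Arrs (factorization_cat M F)" "Src (factorization_cat M F) h = Tgt (factorization_cat M F) g"
    "Src (factorization_cat M F) k = Tgt (factorization_cat M F) h"
  then obtain W X Y Z c d e where g: "g = (W, c, X)" "h = (X, d, Y)" "k = (Y, e, Z)"
    and c: "is_morphism M W c X"
    by (auto simp: factorization_cat_def)
  \<comment> \<open>In the bracketing (e \<circ> d) \<circ> c the inner composite is restricted to
    the points of X; since c lands there, both bracketings agree.\<close>
  have "c q \<in> points (phase X)" if "q \<in> points (phase W)" for q
    using c that smooth_map_in_points unfolding is_morphism_def by metis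
  then show "Cmp (factorization_cat M F) k (Cmp (factorization_cat M F) h g) =
      Cmp (factorization_cat M F) (Cmp (factorization_cat M F) k h) g"
    by (auto simp: g factorization_cat_def compose_def fun_eq_iff)
qed (auto simp: factorization_cat_def is_morphism_ident[OF F])

section \<open>Transport of factorizations and arrows along f\<close>

lemma smooth_factorization_induced_obj:
  assumes N: "smooth_manifold N" "smooth_manifold N'" and f: "smooth_map N N' f"
    and X: "smooth_factorization M N u X"
  shows "smooth_factorization M N' (f \<circ> u) (induced_obj f X)"
proof -
  have "inner X p \<in> points (phase X)" if "p \<in> points M" for p
    using X that smooth_map_in_points unfolding smooth_factorization_def by metis
  moreover have "smooth_map (phase X) N' (compose (points (phase X)) f (outer X))"
    using X by (intro smooth_map_compose_on_points[OF _ N _ f]) (auto simp: smooth_factorization_def)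
  ultimately show ?thesis
    using X by (auto simp: smooth_factorization_def induced_obj_def compose_eq)
qed

lemma is_morphism_induced_obj:
  assumes "is_morphism M X c Y"
  shows "is_morphism M (induced_obj f X) c (induced_obj f Y)"
proof -
  have "c q \<in> points (phase Y)" if "q \<in> points (phase X)" for q
    using assms that smooth_map_in_points unfolding is_morphism_def by metis
  then show ?thesis
    using assms by (auto simp: is_morphism_def induced_obj_def compose_eq)
qed

text \<open>Treats both categories at once: whether c is an arrow does not depend on the class F of
  objects, so a functor only requires that objects of F are sent into F'. The functor laws hold
  because the phase space and c are unchanged.\<close>

lemma covariant_functor_factorization_cat:
  assumes "\<And>X. X \<in> F \<Longrightarrow> smooth_factorization M N u X"
    and "\<And>X. X \<in> F' \<Longrightarrow> smooth_factorization M N' u' X"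
    and "\<And>X. X \<in> F \<Longrightarrow> induced_obj f X \<in> F'"
  shows "covariant_functor (factorization_cat M F) (factorization_cat M F') (induced_obj f) (induced_arr f)"
proof (intro covariant_functor.intro covariant_functor_axioms.intro)
  show "category (factorization_cat M F)"
    by (rule category_factorization_cat) (rule assms(1))
  show "category (factorization_cat M F')"
    by (rule category_factorization_cat) (rule assms(2))
  show "induced_arr f (Ident (factorization_cat M F) X) = Ident (factorization_cat M F') (induced_obj f X)"
    for X by (simp add: factorization_cat_def induced_arr_def induced_obj_def)
  show "induced_arr f (Cmp (factorization_cat M F) h g) =
      Cmp (factorization_cat M F') (induced_arr f h) (induced_arr f g)" for g h
    by (simp add: factorization_cat_def induced_arr_def induced_obj_def split: prod.splits)
qed (auto simp: factorization_cat_def induced_arr_def is_morphism_induced_obj assms(3))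

theorem proposition5:
  fixes M :: "'m manifold" and N :: "'n manifold" and N' :: "'k manifold"
    and u :: "'m \<Rightarrow> 'n" and f :: "'n \<Rightarrow> 'k"
  assumes "smooth_manifold M" and "smooth_manifold N" and "smooth_manifold N'"
    and "smooth_map M N u" and "smooth_map N N' f"
  shows "covariant_functor
           (QuasiP M N u :: (('m, 'c, 'n) factorization, ('m, 'c, 'n) arrow) cat)
           (QuasiP M N' (f \<circ> u) :: (('m, 'c, 'k) factorization, ('m, 'c, 'k) arrow) cat)
           (induced_obj f) (induced_arr f) \<and>
         covariant_functor
           (Const M N u :: (('m, 'c, 'n) factorization, ('m, 'c, 'n) arrow) cat)
           (Const M N' (f \<circ> u) :: (('m, 'c, 'k) factorization, ('m, 'c, 'k) arrow) cat)
           (induced_obj f) (induced_arr f)"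
proof -
  note induced = smooth_factorization_induced_obj[OF assms(2,3,5)]
  have inner: "inner (induced_obj f X) = inner X" "phase (induced_obj f X) = phase X"
    for X :: "('m, 'c, 'n) factorization"
    by (simp_all add: induced_obj_def)
  show ?thesis
    unfolding QuasiP_def Const_def
  proof (intro conjI covariant_functor_factorization_cat)
    fix X :: "('m, 'c, 'n) factorization"
    assume "X \<in> {X. quasiperiodic_factorization M N u X}"
    then show "induced_obj f X \<in> {X. quasiperiodic_factorization M N' (f \<circ> u) X}"
      using induced by (auto simp: quasiperiodic_factorization_def inner)
  next
    fix X :: "('m, 'c, 'n) factorization"
    assume "X \<in> {X. constant_rank_factorization M N u X}"
    then show "induced_obj f X \<in> {X. constant_rank_factorization M N' (f \<circ> u) X}"
      using induced by (auto simp: constant_rank_factorization_def inner)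
  qed (auto simp: quasiperiodic_factorization_def constant_rank_factorization_def)
qed

end
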